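(* For non-constant symmetric Boolean functions $f:\{0,1\}^N\to\{0,1\}$ we have $Q_E(f)\in\Theta(N)$ and $Q_0(f)\in\Theta(N)$. That is, there are absolute constants $c_1,c_2>0$ such that for every $N\ge1$ and every non-constant symmetric $f:\{0,1\}^N\to\{0,1\}$, $c_1N\le Q_E(f)\le c_2N$ and $c_1N\le Q_0(f)\le c_2N$.
   Context: $f$ is symmetric if $f(X)$ depends only on the Hamming weight $|X|$ (number of 1s in $X$). Quantum networks: the input $X=(x_0,\ldots,x_{N-1})\in\{0,1\}^N$ is given as a black-box. A quantum network with $T$ queries acts on $m$ qubits (for some $m$) and is a sequence of unitary transformations $U_0,O,U_1,O,\ldots,U_{T-1},O,U_T$ applied in this order to the initial state $|0\rangle$, where the $U_j$ are arbitrary unitaries on $m$ qubits not depending on $X$, and the query $O$ (depending on $X$) maps each basis state $|i,b,z\rangle$ to $|i,b\oplus x_i,z\rangle$; here $i$ consists of $\lceil\log_2 N\rceil$ bits, $b$ is one bit, and $z$ consists of the remaining $m-\lceil\log_2 N\rceil-1$ bits (if $i\ge N$, the query leaves the basis state unchanged). Exact computation: the output is the value obtained by measuring the rightmost bit of the final state in the computational basis; the network computes $f$ exactly if for every $X\in\{0,1\}^N$ the output equals $f(X)$ with certainty. Zero-error computation: the output is obtained by measuring the two rightmost bits of the final state. If the first of these two bits is 0 the answer is "inconclusive"; otherwise the second bit is the answer. The network computes $f$ with zero error if for every $X\in\{0,1\}^N$ the answer, whenever it is not "inconclusive", equals $f(X)$ with certainty, and the probability of "inconclusive" is less than $1/2$.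 $Q_E(f)$ and $Q_0(f)$ are the minimum $T$ such that some quantum network with $T$ queries computes $f$ exactly, respectively with zero error. *)

theory Defs
  imports Complex_Main "Jordan_Normal_Form.Schur_Decomposition"
begin

(* An input X in {0,1}^N is a bool list of length N, with x_i = X ! i.  A Boolean function on
   {0,1}^N is a function on bool lists of which only the values on lists of length N matter. *)

definition hamming_weight :: "bool list \<Rightarrow> nat" where
  "hamming_weight X = count_list X True"

definition symmetric_fun :: "nat \<Rightarrow> (bool list \<Rightarrow> bool) \<Rightarrow> bool" where
  "symmetric_fun N f \<longleftrightarrow>
     (\<forall>X Y. length X = N \<and> length Y = N \<and> hamming_weight X = hamming_weight Y \<longrightarrow> f X = f Y)"

definition non_constant :: "nat \<Rightarrow> (bool list \<Rightarrow> bool) \<Rightarrow> bool" where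
  "non_constant N f \<longleftrightarrow> (\<exists>X Y. length X = N \<and> length Y = N \<and> f X \<noteq> f Y)"

definition unitary_mat :: "nat \<Rightarrow> complex mat \<Rightarrow> bool" where
  "unitary_mat d U \<longleftrightarrow> U \<in> carrier_mat d d \<and>
     mat_adjoint U * U = 1\<^sub>m d \<and> U * mat_adjoint U = 1\<^sub>m d"

definition index_bits :: "nat \<Rightarrow> nat" where
  "index_bits N = nat \<lceil>log 2 (real N)\<rceil>"

(* Pure states of m qubits are vectors of dimension 2^m.  A basis state is the number whose
   m-digit binary expansion it is, leftmost qubit most significant.  With w the number of z-bits,
   |i,b,z> is i * 2^(w+1) + b * 2^w + z, so b is the bit at position w. *)

definition query_basis :: "nat \<Rightarrow> nat \<Rightarrow> bool list \<Rightarrow> nat \<Rightarrow> nat" where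
  "query_basis N m X k =
     (let w = m - index_bits N - 1; i = k div 2 ^ (w + 1)
      in if i < N \<and> X ! i then flip_bit w k else k)"

definition query_mat :: "nat \<Rightarrow> nat \<Rightarrow> bool list \<Rightarrow> complex mat" where
  "query_mat N m X =
     mat (2 ^ m) (2 ^ m) (\<lambda>(r, c). if r = query_basis N m X c then 1 else 0)"

(* U j is the unitary U_j; only U 0, ..., U T are used. *)

definition quantum_network :: "nat \<Rightarrow> nat \<Rightarrow> nat \<Rightarrow> (nat \<Rightarrow> complex mat) \<Rightarrow> bool" where
  "quantum_network N m T U \<longleftrightarrow>
     index_bits N + 1 \<le> m \<and> (\<forall>j\<le>T. unitary_mat (2 ^ m) (U j))"

fun network_state ::
  "nat \<Rightarrow> nat \<Rightarrow> (nat \<Rightarrow> complex mat) \<Rightarrow> bool list \<Rightarrow> nat \<Rightarrow> complex vec" where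
  "network_state N m U X 0 = U 0 *\<^sub>v unit_vec (2 ^ m) 0"
| "network_state N m U X (Suc t) =
     U (Suc t) *\<^sub>v (query_mat N m X *\<^sub>v network_state N m U X t)"

definition measure_prob :: "nat \<Rightarrow> complex vec \<Rightarrow> (nat \<Rightarrow> bool) \<Rightarrow> real" where
  "measure_prob m \<psi> P = (\<Sum>k | k < 2 ^ m \<and> P k. (cmod (\<psi> $ k))\<^sup>2)"

(* In the basis state k, the rightmost qubit is bit k 0 and its left neighbour is bit k 1. *)

definition computes_exactly ::
  "nat \<Rightarrow> nat \<Rightarrow> nat \<Rightarrow> (nat \<Rightarrow> complex mat) \<Rightarrow> (bool list \<Rightarrow> bool) \<Rightarrow> bool" where
  "computes_exactly N m T U f \<longleftrightarrow>
     (\<forall>X. length X = N \<longrightarrow>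
        measure_prob m (network_state N m U X T) (\<lambda>k. bit k 0 = f X) = 1)"

definition computes_zero_error ::
  "nat \<Rightarrow> nat \<Rightarrow> nat \<Rightarrow> (nat \<Rightarrow> complex mat) \<Rightarrow> (bool list \<Rightarrow> bool) \<Rightarrow> bool" where
  "computes_zero_error N m T U f \<longleftrightarrow> 2 \<le> m \<and>
     (\<forall>X. length X = N \<longrightarrow>
        measure_prob m (network_state N m U X T) (\<lambda>k. bit k 1 \<and> bit k 0 \<noteq> f X) = 0 \<and>
        measure_prob m (network_state N m U X T) (\<lambda>k. \<not> bit k 1) < 1 / 2)"

(* Suitable networks always exist (N queries suffice to read the input), so for N \<ge> 1 the least
   elements below are attained minima. *)

definition Q_E :: "nat \<Rightarrow> (bool list \<Rightarrow> bool) \<Rightarrow> nat" where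
  "Q_E N f = (LEAST T. \<exists>m U. quantum_network N m T U \<and> computes_exactly N m T U f)"

definition Q_0 :: "nat \<Rightarrow> (bool list \<Rightarrow> bool) \<Rightarrow> nat" where
  "Q_0 N f = (LEAST T. \<exists>m U. quantum_network N m T U \<and> computes_zero_error N m T U f)"

end

theory Submission
  imports Defs
begin

text \<open>
  After \<open>T\<close> queries every amplitude is a multilinear polynomial of degree at most \<open>T\<close> in the input
  bits, so the probability of the outcome ``conclusive, answer 1'' is one of degree at most \<open>2T\<close>.  It vanishes
  exactly on the inputs with \<open>f = 0\<close>.  Averaging it over the inputs of weight \<open>k\<close> gives a nonzero
  univariate polynomial in \<open>k\<close>, still of degree at most \<open>2T\<close>, whose roots include all weights on
  which \<open>f\<close> is 0; hence there are at most \<open>2T\<close> such weights.  The same holds for the value 1, and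
  so \<open>N + 1 \<le> 4T\<close>.  Conversely, \<open>N\<close> queries with permutation matrices in between read the whole
  input.
\<close>

section \<open>Low-degree functions on subsets\<close>

text \<open>The input \<open>X\<close> is identified with the set of positions of its 1s, so that \<open>of_bool (S \<subseteq> A)\<close> is
  the monomial \<open>\<Prod>i\<in>S. x\<^sub>i\<close>.\<close>

inductive_set polys :: "nat \<Rightarrow> nat \<Rightarrow> (nat set \<Rightarrow> complex) set" for N d :: nat where
  polys_zero: "(\<lambda>A. 0) \<in> polys N d"
| polys_monomial: "F \<in> polys N d \<Longrightarrow> S \<subseteq> {..<N} \<Longrightarrow> card S \<le> d \<Longrightarrow>
    (\<lambda>A. F A + c * of_bool (S \<subseteq> A)) \<in> polys N d"

lemma monomial_in_polys:
  assumes "S \<subseteq> {..<N}" "card S \<le> d"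
  shows "(\<lambda>A. c * of_bool (S \<subseteq> A)) \<in> polys N d"
  using polys_monomial[OF polys_zero assms, of c] by simp

lemma polys_const: "(\<lambda>A. c) \<in> polys N d"
  using monomial_in_polys[of "{}" N d c] by simp

lemma polys_mono:
  assumes "F \<in> polys N d" "d \<le> e"
  shows "F \<in> polys N e"
  using assms by induction (auto intro: polys_zero polys_monomial)

lemma polys_add:
  assumes "F \<in> polys N d" "G \<in> polys N d"
  shows "(\<lambda>A. F A + G A) \<in> polys N d"
  using assms(2)
proof induction
  case polys_zero
  then show ?case using assms(1) by simp
next
  case (polys_monomial G S c)
  then show ?case
    using polys.polys_monomial[of "\<lambda>A. F A + G A" N d S c] by (simp add: add.assoc)
qed

lemma polys_sum:
  assumes "\<And>k. k \<in> K \<Longrightarrow> F k \<in> polys N d"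
  shows "(\<lambda>A. \<Sum>k\<in>K. F k A) \<in> polys N d"
  using assms
proof (induction K rule: infinite_finite_induct)
  case (insert x K)
  then show ?case by (simp add: polys_add)
qed (auto intro: polys_zero)

text \<open>Bits are idempotent, so the monomials of \<open>R\<close> and \<open>S\<close> multiply
  to the monomial of \<open>R \<union> S\<close>, whose size is at most the sum of the two sizes.
  Products therefore stay multilinear while degrees add.\<close>

lemma polys_mult_monomial:
  assumes "F \<in> polys N d" "S \<subseteq> {..<N}" "card S \<le> e"
  shows "(\<lambda>A. F A * (c * of_bool (S \<subseteq> A))) \<in> polys N (d + e)"
  using assms(1)
proof induction
  case polys_zero
  then show ?case by (simp add: polys.polys_zero)
next
  case (polys_monomial F R b)
  have "card (R \<union> S) \<le> d + e"
    using card_Un_le[of R S] polys_monomial assms(3) by linarith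
  then have "(\<lambda>A. F A * (c * of_bool (S \<subseteq> A)) + b * c * of_bool (R \<union> S \<subseteq> A)) \<in> polys N (d + e)"
    using polys_monomial assms(2) by (intro polys.polys_monomial) auto
  also have "(\<lambda>A. F A * (c * of_bool (S \<subseteq> A)) + b * c * of_bool (R \<union> S \<subseteq> A)) =
    (\<lambda>A. (F A + b * of_bool (R \<subseteq> A)) * (c * of_bool (S \<subseteq> A)))"
    by (auto simp: fun_eq_iff algebra_simps)
  finally show ?case .
qed

lemma polys_mult:
  assumes "F \<in> polys N d" "G \<in> polys N e"
  shows "(\<lambda>A. F A * G A) \<in> polys N (d + e)"
  using assms(2)
proof induction
  case polys_zero
  then show ?case by (simp add: polys.polys_zero)
next
  case (polys_monomial G S c)
  then show ?case
    using polys_add[OF polys_monomial.IH polys_mult_monomial[OF assms(1) polys_monomial.hyps(2,3), of c]]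
    by (simp add: algebra_simps)
qed

lemma polys_cnj:
  assumes "F \<in> polys N d"
  shows "(\<lambda>A. cnj (F A)) \<in> polys N d"
  using assms
proof induction
  case polys_zero
  then show ?case by (simp add: polys.polys_zero)
next
  case (polys_monomial F S c)
  have *: "cnj (of_bool b) = of_bool b" for b by (cases b) auto
  show ?case
    using polys.polys_monomial[OF polys_monomial.IH polys_monomial.hyps(2,3), of "cnj c"]
    by (simp add: *)
qed

section \<open>Symmetrization\<close>

text \<open>Removing \<open>S\<close> gives a bijection onto the subsets of size
  \<open>k - card S\<close> of the other \<open>N - card S\<close> positions; the rest is a binomial
  identity. The product form avoids division of natural numbers.\<close>

lemma card_supersets_of_card:
  assumes "S \<subseteq> {..<N}"
  shows "card {A. A \<subseteq> {..<N} \<and> card A = k \<and> S \<subseteq> A} * (N choose card S) =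
    (N choose k) * (k choose card S)"
proof (cases "card S \<le> k")
  case True
  have fin: "finite S" using assms finite_subset by blast
  have "bij_betw (\<lambda>A. A - S) {A. A \<subseteq> {..<N} \<and> card A = k \<and> S \<subseteq> A}
      {B. B \<subseteq> {..<N} - S \<and> card B = k - card S}"
  proof (rule bij_betw_byWitness[where f' = "\<lambda>B. B \<union> S"])
    show "(\<lambda>B. B \<union> S) ` {B. B \<subseteq> {..<N} - S \<and> card B = k - card S}
        \<subseteq> {A. A \<subseteq> {..<N} \<and> card A = k \<and> S \<subseteq> A}"
    proof clarsimp
      fix B assume B: "B \<subseteq> {..<N} - S" "card B = k - card S"
      then have "finite B" "B \<inter> S = {}" by (auto intro: finite_subset[of B "{..<N}"])
      then have "card (B \<union> S) = k" using fin B True by (simp add: card_Un_disjoint)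
      then show "B \<subseteq> {..<N} \<and> S \<subseteq> {..<N} \<and> card (B \<union> S) = k" using B assms by auto
    qed
  qed (use fin in \<open>auto simp: card_Diff_subset\<close>)
  then have "card {A. A \<subseteq> {..<N} \<and> card A = k \<and> S \<subseteq> A} =
      card {B. B \<subseteq> {..<N} - S \<and> card B = k - card S}"
    by (rule bij_betw_same_card)
  also have "\<dots> = (N - card S) choose (k - card S)"
    using fin assms by (simp add: n_subsets card_Diff_subset)
  finally have c: "card {A. A \<subseteq> {..<N} \<and> card A = k \<and> S \<subseteq> A} = (N - card S) choose (k - card S)" .
  show ?thesis
  proof (cases "k \<le> N")
    case kN: True
    show ?thesis using choose_mult[OF True kN] c by (simp add: mult.commute)
  next
    \<comment> \<open>Above \<open>N\<close> the identity is outside the range of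
      \<open>choose_mult\<close>, but both sides are 0.\<close>
    case False
    moreover have "card S \<le> N" using assms card_mono[of "{..<N}" S] by simp
    ultimately have "N - card S < k - card S" by linarith
    then show ?thesis using c False by (simp add: binomial_eq_0)
  qed
next
  case False
  then have "{A. A \<subseteq> {..<N} \<and> card A = k \<and> S \<subseteq> A} = {}"
    using card_mono[of _ S] by (auto dest: finite_subset)
  with False show ?thesis by (simp only:) (simp add: binomial_eq_0)
qed

definition binomial_poly :: "nat \<Rightarrow> complex poly" where
  "binomial_poly s = smult (1 / fact s) (\<Prod>i<s. [:- of_nat i, 1:])"

lemma degree_binomial_poly: "degree (binomial_poly s) \<le> s"
proof -
  have "degree (\<Prod>i<s. [:- of_nat i, 1:] :: complex poly) \<le> sum (degree \<circ> (\<lambda>i. [:- of_nat i, 1:] :: complex poly)) {..<s}"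
    by (rule degree_prod_sum_le) simp
  then show ?thesis unfolding binomial_poly_def
    using degree_smult_le le_trans by fastforce
qed

lemma poly_binomial_poly: "poly (binomial_poly s) (of_nat k) = of_nat (k choose s)"
  by (simp add: binomial_poly_def poly_prod binomial_gbinomial gbinomial_prod_rev
      atLeast0LessThan)

text \<open>By linearity one monomial suffices: with \<open>s = card S\<close>, its average over the
  sets of size \<open>k\<close> is \<open>(k choose s) / (N choose s)\<close>, a polynomial in
  \<open>k\<close> of degree at most \<open>s\<close>. The factor \<open>N choose k\<close> turns
  averages into sums and makes both sides 0 for \<open>k > N\<close>.\<close>

lemma polys_symmetrize:
  assumes "F \<in> polys N d"
  shows "\<exists>p. degree p \<le> d \<and> (\<forall>k. (\<Sum>A | A \<subseteq> {..<N} \<and> card A = k. F A) =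
    of_nat (N choose k) * poly p (of_nat k))"
  using assms
proof induction
  case polys_zero
  show ?case by (intro exI[of _ 0]) simp
next
  case (polys_monomial F S c)
  then obtain p where p: "degree p \<le> d"
    "\<And>k. (\<Sum>A | A \<subseteq> {..<N} \<and> card A = k. F A) = of_nat (N choose k) * poly p (of_nat k)"
    by blast
  define q where "q = smult (c / of_nat (N choose card S)) (binomial_poly (card S))"
  have "card S \<le> N" using polys_monomial card_mono[of "{..<N}" S] by simp
  then have nz: "(of_nat (N choose card S) :: complex) \<noteq> 0" by simp
  have "degree q \<le> d"
    unfolding q_def using degree_smult_le degree_binomial_poly polys_monomial(3) le_trans by blast
  then have "degree (p + q) \<le> d" using p by (simp add: degree_add_le)
  moreover have "(\<Sum>A | A \<subseteq> {..<N} \<and> card A = k. F A + c * of_bool (S \<subseteq> A)) =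
      of_nat (N choose k) * poly (p + q) (of_nat k)" for k
  proof -
    have fin: "finite {A. A \<subseteq> {..<N} \<and> card A = k}"
      by (rule finite_subset[of _ "Pow {..<N}"]) auto
    have "(\<Sum>A | A \<subseteq> {..<N} \<and> card A = k. of_bool (S \<subseteq> A) :: complex) =
        of_nat (card {A. A \<subseteq> {..<N} \<and> card A = k \<and> S \<subseteq> A})"
      using fin by (simp add: sum_of_bool_eq Int_def conj_assoc)
    also have "\<dots> = of_nat (N choose k) * of_nat (k choose card S) / of_nat (N choose card S)"
      using arg_cong[OF card_supersets_of_card[OF polys_monomial(2), of k], of "of_nat :: nat \<Rightarrow> complex"] nz
      by (simp add: field_simps)
    finally show ?thesis using nz
      by (simp add: sum.distrib p q_def poly_binomial_poly algebra_simps flip: sum_distrib_left)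
  qed
  ultimately show ?case by blast
qed

text \<open>Nonnegativity rules out cancellation in the sum over a weight class: at
  \<open>k0\<close> the sum is positive, so the symmetrized polynomial is not zero, and each weight
  where \<open>g\<close> fails is one of its roots.\<close>

lemma card_zero_weights_le:
  fixes G :: "nat set \<Rightarrow> real"
  assumes G: "(\<lambda>A. complex_of_real (G A)) \<in> polys N d"
    and nonneg: "\<And>A. 0 \<le> G A"
    and zero_iff: "\<And>A. A \<subseteq> {..<N} \<Longrightarrow> G A = 0 \<longleftrightarrow> \<not> g (card A)"
    and k0: "k0 \<le> N" "g k0"
  shows "card {k. k \<le> N \<and> \<not> g k} \<le> d"
proof -
  obtain p where p: "degree p \<le> d"
    "\<And>k. (\<Sum>A | A \<subseteq> {..<N} \<and> card A = k. complex_of_real (G A)) =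
      of_nat (N choose k) * poly p (of_nat k)"
    using polys_symmetrize[OF G] by blast
  have fin: "finite {A. A \<subseteq> {..<N} \<and> card A = k}" for k
    by (rule finite_subset[of _ "Pow {..<N}"]) auto
  have "(\<Sum>A | A \<subseteq> {..<N} \<and> card A = k0. G A) > 0"
  proof (rule sum_pos[OF fin])
    show "{A. A \<subseteq> {..<N} \<and> card A = k0} \<noteq> {}"
      using k0 by (auto intro!: exI[of _ "{..<k0}"])
    show "G A > 0" if "A \<in> {A. A \<subseteq> {..<N} \<and> card A = k0}" for A
      using that zero_iff[of A] nonneg[of A] k0 by auto
  qed
  then have "(\<Sum>A | A \<subseteq> {..<N} \<and> card A = k0. complex_of_real (G A)) \<noteq> 0"
    by (simp flip: of_real_sum)
  then have "p \<noteq> 0" using p(2)[of k0] by auto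
  have "of_nat k \<in> {x. poly p x = 0}" if "k \<le> N" "\<not> g k" for k
  proof -
    have "(\<Sum>A | A \<subseteq> {..<N} \<and> card A = k. complex_of_real (G A)) = 0"
      using zero_iff that by (intro sum.neutral) auto
    \<comment> \<open>The factor \<open>N choose k\<close> is nonzero because
      \<open>k \<le> N\<close>.\<close>
    then show ?thesis using p(2)[of k] that by simp
  qed
  then have "of_nat ` {k. k \<le> N \<and> \<not> g k} \<subseteq> {x. poly p x = 0}" by auto
  then have "card (of_nat ` {k. k \<le> N \<and> \<not> g k} :: complex set) \<le> card {x. poly p x = 0}"
    using poly_roots_finite[OF \<open>p \<noteq> 0\<close>] by (intro card_mono) auto
  also have "\<dots> \<le> degree p" by (rule card_poly_roots_bound[OF \<open>p \<noteq> 0\<close>])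
  finally show ?thesis using p(1) by (simp add: card_image inj_on_def)
qed

section \<open>Amplitudes of a network\<close>

lemma flip_bit_less: "flip_bit w k < 2 ^ m" if "w < m" "k < 2 ^ m" for w k m :: nat
proof -
  have "take_bit m (flip_bit w k) = flip_bit w k"
    using that by (simp add: take_bit_flip_bit_eq take_bit_nat_eq_self)
  then show ?thesis by (simp add: take_bit_nat_eq_self_iff)
qed

lemma flip_bit_flip_bit: "flip_bit w (flip_bit w k) = k" for w k :: nat
  by (rule bit_eqI) (auto simp: bit_flip_bit_iff)

lemma flip_bit_div: "flip_bit w k div 2 ^ Suc w = k div 2 ^ Suc w" for w k :: nat
proof -
  have "drop_bit (Suc w) (flip_bit w k) = drop_bit (Suc w) k"
    by (rule bit_eqI) (auto simp: bit_drop_bit_eq bit_flip_bit_iff)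
  then show ?thesis by (simp add: drop_bit_eq_div)
qed

lemma query_basis_less:
  assumes "index_bits N + 1 \<le> m" "k < 2 ^ m"
  shows "query_basis N m X k < 2 ^ m"
  using assms by (auto simp: query_basis_def Let_def intro!: flip_bit_less)

text \<open>Flipping the target bit leaves the index register above it unchanged, so a second query
  consults the same input bit and undoes the flip.\<close>

lemma query_basis_involution: "query_basis N m X (query_basis N m X k) = k"
  using flip_bit_div[of "m - index_bits N - 1" k]
  by (auto simp: query_basis_def Let_def flip_bit_flip_bit)

lemma query_mat_mult_vec:
  assumes "index_bits N + 1 \<le> m" "dim_vec v = 2 ^ m" "r < 2 ^ m"
  shows "(query_mat N m X *\<^sub>v v) $ r = v $ query_basis N m X r"
proof -
  have "(query_mat N m X *\<^sub>v v) $ r =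
      (\<Sum>c\<in>{0..<2 ^ m}. (if r = query_basis N m X c then 1 else 0) * v $ c)"
    using assms by (simp add: query_mat_def scalar_prod_def)
  also have "\<dots> = (\<Sum>c\<in>{0..<2 ^ m}. if query_basis N m X r = c then v $ c else 0)"
    by (intro sum.cong) (auto simp: query_basis_involution)
  also have "\<dots> = v $ query_basis N m X r"
    using query_basis_less[OF assms(1,3), of X] by simp
  finally show ?thesis .
qed

lemma query_mat_carrier [simp]: "query_mat N m X \<in> carrier_mat (2 ^ m) (2 ^ m)"
  by (simp add: query_mat_def)

lemma network_state_carrier:
  assumes "quantum_network N m T U" "t \<le> T"
  shows "network_state N m U X t \<in> carrier_vec (2 ^ m)"
  using assms(2)
proof (induction t)
  case 0
  then show ?case using assms(1)
    by (auto simp: quantum_network_def unitary_mat_def intro!: mult_mat_vec_carrier[of _ _ "2 ^ m"])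
next
  case (Suc t)
  then have "U (Suc t) \<in> carrier_mat (2 ^ m) (2 ^ m)"
    using assms(1) by (auto simp: quantum_network_def unitary_mat_def)
  then show ?case
    using Suc by (auto intro!: mult_mat_vec_carrier[of _ _ "2 ^ m"] mult_mat_vec_carrier[OF query_mat_carrier])
qed

text \<open>A query multiplies old amplitudes by at most one input bit, raising the degree by at
  most one; the unitaries do not depend on the input and only form linear combinations with constant
  coefficients.\<close>

lemma amplitude_in_polys:
  assumes "quantum_network N m T U" "t \<le> T" "r < 2 ^ m"
  shows "(\<lambda>A. network_state N m U (map (\<lambda>i. i \<in> A) [0..<N]) t $ r) \<in> polys N t"
  using assms(2,3)
proof (induction t arbitrary: r)
  case 0
  then show ?case by (simp add: polys_const)
next
  case (Suc t)
  let ?X = "\<lambda>A. map (\<lambda>i. i \<in> A) [0..<N]"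
  let ?\<psi> = "\<lambda>A. network_state N m U (?X A) t"
  have m: "index_bits N + 1 \<le> m" and U: "U (Suc t) \<in> carrier_mat (2 ^ m) (2 ^ m)"
    using assms(1) Suc.prems by (auto simp: quantum_network_def unitary_mat_def)
  have dim: "dim_vec (?\<psi> A) = 2 ^ m" for A
    using network_state_carrier[OF assms(1), of t] Suc.prems by auto
  have query: "(\<lambda>A. (query_mat N m (?X A) *\<^sub>v ?\<psi> A) $ c) \<in> polys N (Suc t)" if c: "c < 2 ^ m" for c
  proof -
    define w where "w = m - index_bits N - 1"
    define i where "i = c div 2 ^ (w + 1)"
    have fc: "flip_bit w c < 2 ^ m" using m c by (auto simp: w_def intro!: flip_bit_less)
    have IH: "(\<lambda>A. ?\<psi> A $ c) \<in> polys N t" "(\<lambda>A. ?\<psi> A $ flip_bit w c) \<in> polys N t"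
      using Suc.IH[OF _ c] Suc.IH[OF _ fc] Suc.prems by auto
    have eq: "(query_mat N m (?X A) *\<^sub>v ?\<psi> A) $ c =
        (if i < N \<and> i \<in> A then ?\<psi> A $ flip_bit w c else ?\<psi> A $ c)" for A
      unfolding query_mat_mult_vec[OF m dim c] query_basis_def Let_def w_def[symmetric] i_def[symmetric]
      by auto
    show ?thesis
    proof (cases "i < N")
      case True
      have x: "(\<lambda>A. a * of_bool ({i} \<subseteq> A)) \<in> polys N 1" for a
        using True by (intro monomial_in_polys) auto
      \<comment> \<open>The choice made by the input bit \<open>x\<close> at position
        \<open>i\<close>, as a polynomial: \<open>x\<close> times the amplitude at the flipped state
        plus \<open>1 - x\<close> times the amplitude at \<open>c\<close>.\<close>
      have "(\<lambda>A. ?\<psi> A $ flip_bit w c * (1 * of_bool ({i} \<subseteq> A)) +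
          (?\<psi> A $ c + ?\<psi> A $ c * ((- 1) * of_bool ({i} \<subseteq> A)))) \<in> polys N (t + 1)"
        by (intro polys_add polys_mult[OF IH(2) x] polys_mult[OF IH(1) x] polys_mono[OF IH(1)]) simp
      also have "(\<lambda>A. ?\<psi> A $ flip_bit w c * (1 * of_bool ({i} \<subseteq> A)) +
          (?\<psi> A $ c + ?\<psi> A $ c * ((- 1) * of_bool ({i} \<subseteq> A)))) =
          (\<lambda>A. (query_mat N m (?X A) *\<^sub>v ?\<psi> A) $ c)"
        using True by (auto simp: eq fun_eq_iff)
      finally show ?thesis by simp
    next
      case False
      then show ?thesis using polys_mono[OF IH(1)] by (simp add: eq)
    qed
  qed
  have "(\<lambda>A. \<Sum>c\<in>{0..<2 ^ m}. U (Suc t) $$ (r, c) * (query_mat N m (?X A) *\<^sub>v ?\<psi> A) $ c)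
      \<in> polys N (Suc t)"
    \<comment> \<open>Matrix entries count as polynomials of degree 0, so the bound remains
      \<open>Suc t\<close>.\<close>
    using polys_mult[OF polys_const[where d = 0] query] by (intro polys_sum) auto
  moreover have "(U (Suc t) *\<^sub>v (query_mat N m (?X A) *\<^sub>v ?\<psi> A)) $ r =
      (\<Sum>c\<in>{0..<2 ^ m}. U (Suc t) $$ (r, c) * (query_mat N m (?X A) *\<^sub>v ?\<psi> A) $ c)" for A
    using U Suc.prems by (simp add: scalar_prod_def query_mat_def)
  ultimately show ?case by simp
qed

text \<open>A squared modulus is an amplitude times its conjugate. Conjugation keeps the degree
  since the input bits are real, so the degree at most doubles.\<close>

lemma measure_prob_in_polys:
  assumes "quantum_network N m T U"
  shows "(\<lambda>A. complex_of_real (measure_prob m (network_state N m U (map (\<lambda>i. i \<in> A) [0..<N]) T) P))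
    \<in> polys N (2 * T)"
proof -
  let ?\<psi> = "\<lambda>A. network_state N m U (map (\<lambda>i. i \<in> A) [0..<N]) T"
  have "(\<lambda>A. ?\<psi> A $ k * cnj (?\<psi> A $ k)) \<in> polys N (2 * T)" if "k < 2 ^ m" for k
    using polys_mult[OF amplitude_in_polys polys_cnj[OF amplitude_in_polys], OF assms order_refl that assms order_refl that]
    by (simp add: mult_2)
  then have "(\<lambda>A. \<Sum>k | k < 2 ^ m \<and> P k. ?\<psi> A $ k * cnj (?\<psi> A $ k)) \<in> polys N (2 * T)"
    by (intro polys_sum) auto
  then show ?thesis
    unfolding measure_prob_def of_real_sum complex_norm_square .
qed

section \<open>Conservation of total probability\<close>

lemma measure_prob_nonneg: "0 \<le> measure_prob m \<psi> P"
  by (auto simp: measure_prob_def intro: sum_nonneg)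

lemma measure_prob_split:
  "measure_prob m \<psi> P = measure_prob m \<psi> (\<lambda>k. P k \<and> Q k) + measure_prob m \<psi> (\<lambda>k. P k \<and> \<not> Q k)"
proof -
  have "{k. k < 2 ^ m \<and> P k} =
      {k. k < 2 ^ m \<and> P k \<and> Q k} \<union> {k. k < 2 ^ m \<and> P k \<and> \<not> Q k}" by auto
  then show ?thesis unfolding measure_prob_def by (simp only:) (rule sum.union_disjoint, auto)
qed

text \<open>In coordinates: the inner product of \<open>U v\<close> with itself equals that of
  \<open>mat_adjoint U (U v)\<close> with \<open>v\<close>, and \<open>mat_adjoint U\<close> cancels
  \<open>U\<close>.\<close>

lemma measure_prob_unitary:
  assumes U: "unitary_mat (2 ^ m) U" and v: "v \<in> carrier_vec (2 ^ m)"
  shows "measure_prob m (U *\<^sub>v v) (\<lambda>_. True) = measure_prob m v (\<lambda>_. True)"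
proof -
  let ?n = "2 ^ m :: nat"
  have Uc: "U \<in> carrier_mat ?n ?n" and UU: "mat_adjoint U * U = 1\<^sub>m ?n"
    using U by (auto simp: unitary_mat_def)
  have Ac: "mat_adjoint U \<in> carrier_mat ?n ?n" using Uc by (auto simp: mat_adjoint_def)
  have adj: "mat_adjoint U $$ (c, r) = cnj (U $$ (r, c))" if "c < ?n" "r < ?n" for c r
    using that Uc by (simp add: mat_adjoint_def mat_of_rows_index)
  have sq: "complex_of_real (measure_prob m \<psi> (\<lambda>_. True)) = (\<Sum>r<?n. \<psi> $ r * cnj (\<psi> $ r))" for \<psi>
    by (simp add: measure_prob_def lessThan_def complex_norm_square flip: of_real_power)
  have "(\<Sum>r<?n. (U *\<^sub>v v) $ r * cnj ((U *\<^sub>v v) $ r)) =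
      (\<Sum>r<?n. \<Sum>c<?n. cnj (U $$ (r, c)) * cnj (v $ c) * (U *\<^sub>v v) $ r)"
    using Uc v by (intro sum.cong) (auto simp: scalar_prod_def sum_distrib_left atLeast0LessThan mult_ac)
  also have "\<dots> = (\<Sum>c<?n. \<Sum>r<?n. cnj (U $$ (r, c)) * cnj (v $ c) * (U *\<^sub>v v) $ r)"
    by (rule sum.swap)
  also have "\<dots> = (\<Sum>c<?n. (mat_adjoint U *\<^sub>v (U *\<^sub>v v)) $ c * cnj (v $ c))"
  proof (intro sum.cong refl)
    fix c assume "c \<in> {..<?n}"
    then have "(mat_adjoint U *\<^sub>v (U *\<^sub>v v)) $ c = (\<Sum>r<?n. cnj (U $$ (r, c)) * (U *\<^sub>v v) $ r)"
      using Uc Ac adj by (simp add: scalar_prod_def atLeast0LessThan)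
    then show "(\<Sum>r<?n. cnj (U $$ (r, c)) * cnj (v $ c) * (U *\<^sub>v v) $ r) =
        (mat_adjoint U *\<^sub>v (U *\<^sub>v v)) $ c * cnj (v $ c)"
      by (simp add: sum_distrib_left sum_distrib_right mult_ac)
  qed
  also have "mat_adjoint U *\<^sub>v (U *\<^sub>v v) = v"
    using assoc_mult_mat_vec[OF Ac Uc v] UU v by simp
  finally show ?thesis using sq[of v] sq[of "U *\<^sub>v v"] by (metis of_real_eq_iff)
qed

lemma measure_prob_query:
  assumes m: "index_bits N + 1 \<le> m" and v: "dim_vec v = 2 ^ m"
  shows "measure_prob m (query_mat N m X *\<^sub>v v) (\<lambda>_. True) = measure_prob m v (\<lambda>_. True)"
  unfolding measure_prob_def
  by (rule sum.reindex_bij_witness[of _ "query_basis N m X" "query_basis N m X"])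
    (auto simp: query_basis_involution query_basis_less[OF m] query_mat_mult_vec[OF m v])

text \<open>Both notions of computation prescribe the probabilities of certain events only; a total
  of 1 allows passing to their complements.\<close>

lemma measure_prob_network_state:
  assumes "quantum_network N m T U" "t \<le> T"
  shows "measure_prob m (network_state N m U X t) (\<lambda>_. True) = 1"
  using assms(2)
proof (induction t)
  case 0
  have "measure_prob m (unit_vec (2 ^ m) 0) (\<lambda>_. True) = (\<Sum>k | k < (2 :: nat) ^ m. if k = 0 then 1 else 0)"
    unfolding measure_prob_def by (intro sum.cong) auto
  also have "\<dots> = 1" by (subst sum.delta) auto
  finally show ?case
    using assms(1) by (simp add: quantum_network_def measure_prob_unitary)
next
  case (Suc t)
  have m: "index_bits N + 1 \<le> m" and U: "unitary_mat (2 ^ m) (U (Suc t))"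
    using assms(1) Suc.prems by (auto simp: quantum_network_def)
  have v: "network_state N m U X t \<in> carrier_vec (2 ^ m)"
    using network_state_carrier[OF assms(1)] Suc.prems by simp
  have "query_mat N m X *\<^sub>v network_state N m U X t \<in> carrier_vec (2 ^ m)"
    using v by (intro mult_mat_vec_carrier[OF query_mat_carrier])
  then show ?case
    using Suc v by (simp add: measure_prob_unitary[OF U] measure_prob_query[OF m])
qed

section \<open>Lower bound\<close>

lemma hamming_weight_indicator:
  assumes "A \<subseteq> {..<N}"
  shows "hamming_weight (map (\<lambda>i. i \<in> A) [0..<N]) = card A"
proof -
  have "hamming_weight (map (\<lambda>i. i \<in> A) [0..<N]) = length (filter (\<lambda>i. i \<in> A) [0..<N])"
    by (simp add: hamming_weight_def count_list_eq_length_filter filter_map comp_def)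
  also have "\<dots> = card (set (filter (\<lambda>i. i \<in> A) [0..<N]))"
    by (rule distinct_card[symmetric]) simp
  also have "set (filter (\<lambda>i. i \<in> A) [0..<N]) = A" using assms by auto
  finally show ?thesis .
qed

text \<open>The value on weight \<open>k\<close> is read off the input whose 1s occupy the first
  \<open>k\<close> positions. Non-constancy provides a weight for each of the two values.\<close>

lemma symmetric_funE:
  assumes "symmetric_fun N f" "non_constant N f"
  obtains g k l where "\<And>A. A \<subseteq> {..<N} \<Longrightarrow> f (map (\<lambda>i. i \<in> A) [0..<N]) = g (card A)"
    "k \<le> N" "g k" "l \<le> N" "\<not> g l"
proof -
  define g where "g k = f (map (\<lambda>i. i \<in> {..<k}) [0..<N])" for k
  have hw: "hamming_weight (map (\<lambda>i. i \<in> {..<k}) [0..<N]) = k" if "k \<le> N" for k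
    using hamming_weight_indicator[of "{..<k}" N] that by simp
  have le: "hamming_weight X \<le> N" if "length X = N" for X
    using that count_le_length[of X True] by (simp add: hamming_weight_def)
  have fg: "f X = g (hamming_weight X)" if "length X = N" for X
  proof -
    have "hamming_weight X = hamming_weight (map (\<lambda>i. i \<in> {..<hamming_weight X}) [0..<N])"
      using hw[OF le[OF that]] by (rule sym)
    moreover have "length (map (\<lambda>i. i \<in> {..<hamming_weight X}) [0..<N]) = N" by simp
    ultimately show ?thesis using assms(1) that unfolding g_def symmetric_fun_def by blast
  qed
  obtain X Y where XY: "length X = N" "length Y = N" "f X \<noteq> f Y"
    using assms(2) by (auto simp: non_constant_def)
  have "f (map (\<lambda>i. i \<in> A) [0..<N]) = g (card A)" if "A \<subseteq> {..<N}" for A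
    using fg[of "map (\<lambda>i. i \<in> A) [0..<N]"] unfolding hamming_weight_indicator[OF that] by simp
  then show ?thesis
    using that[of g "hamming_weight X" "hamming_weight Y"] that[of g "hamming_weight Y" "hamming_weight X"]
      fg[OF XY(1)] fg[OF XY(2)] le[OF XY(1)] le[OF XY(2)] XY(3) by blast
qed

text \<open>The common core of the exact and zero-error bounds: \<open>P b\<close> stands for the
  event that the network answers \<open>b\<close>.\<close>

lemma query_lower_bound:
  assumes sym: "symmetric_fun N f" "non_constant N f" and net: "quantum_network N m T U"
    and zero_iff: "\<And>b X. length X = N \<Longrightarrow>
      measure_prob m (network_state N m U X T) (P b) = 0 \<longleftrightarrow> f X \<noteq> b"
  shows "N + 1 \<le> 4 * T"
proof -
  obtain g k l where g: "\<And>A. A \<subseteq> {..<N} \<Longrightarrow> f (map (\<lambda>i. i \<in> A) [0..<N]) = g (card A)"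
    and kl: "k \<le> N" "g k" "l \<le> N" "\<not> g l"
    using symmetric_funE[OF sym] by blast
  have "card {k. k \<le> N \<and> \<not> g k} \<le> 2 * T"
    by (rule card_zero_weights_le[OF measure_prob_in_polys[OF net, of "P True"], where ?k0.0 = k])
      (use zero_iff[of _ True] g kl in \<open>auto simp: measure_prob_nonneg\<close>)
  moreover have "card {k. k \<le> N \<and> \<not> \<not> g k} \<le> 2 * T"
    by (rule card_zero_weights_le[OF measure_prob_in_polys[OF net, of "P False"], where ?k0.0 = l])
      (use zero_iff[of _ False] g kl in \<open>auto simp: measure_prob_nonneg\<close>)
  \<comment> \<open>The two classes partition the \<open>N + 1\<close> possible weights.\<close>
  moreover have "card {k. k \<le> N \<and> \<not> g k} + card {k. k \<le> N \<and> \<not> \<not> g k} = card {..N}"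
    by (subst card_Un_disjoint[symmetric]) (auto intro!: arg_cong[where f = card] simp del: card_atMost)
  ultimately show ?thesis by simp
qed

lemma exact_lower_bound:
  assumes "symmetric_fun N f" "non_constant N f" "quantum_network N m T U" "computes_exactly N m T U f"
  shows "N + 1 \<le> 4 * T"
proof (rule query_lower_bound[OF assms(1-3), where P = "\<lambda>b k. bit k 0 = b"])
  fix b and X :: "bool list" assume X: "length X = N"
  let ?\<psi> = "network_state N m U X T"
  have total: "measure_prob m ?\<psi> (\<lambda>_. True) = 1"
    by (rule measure_prob_network_state[OF assms(3)]) simp
  have one: "measure_prob m ?\<psi> (\<lambda>k. bit k 0 = f X) = 1"
    using assms(4) X by (simp add: computes_exactly_def)
  then have "measure_prob m ?\<psi> (\<lambda>k. bit k 0 \<noteq> f X) = 0"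
    using measure_prob_split[of m ?\<psi> "\<lambda>_. True" "\<lambda>k. bit k 0 = f X"] total by simp
  then show "measure_prob m ?\<psi> (\<lambda>k. bit k 0 = b) = 0 \<longleftrightarrow> f X \<noteq> b"
    using one by (cases "f X"; cases b) auto
qed

text \<open>The bound on the inconclusive probability leaves positive probability for conclusive
  outcomes, and all of it falls on the right answer because the wrong one has probability 0.\<close>

lemma zero_error_lower_bound:
  assumes "symmetric_fun N f" "non_constant N f" "quantum_network N m T U"
    "computes_zero_error N m T U f"
  shows "N + 1 \<le> 4 * T"
proof (rule query_lower_bound[OF assms(1-3), where P = "\<lambda>b k. bit k 1 \<and> bit k 0 = b"])
  fix b and X :: "bool list" assume X: "length X = N"
  let ?\<psi> = "network_state N m U X T"
  have total: "measure_prob m ?\<psi> (\<lambda>_. True) = 1"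
    by (rule measure_prob_network_state[OF assms(3)]) simp
  have wrong: "measure_prob m ?\<psi> (\<lambda>k. bit k 1 \<and> bit k 0 \<noteq> f X) = 0"
    and inc: "measure_prob m ?\<psi> (\<lambda>k. \<not> bit k 1) < 1 / 2"
    using assms(4) X by (auto simp: computes_zero_error_def)
  have "measure_prob m ?\<psi> (\<lambda>k. bit k 1) > 0"
    using measure_prob_split[of m ?\<psi> "\<lambda>_. True" "\<lambda>k. bit k 1"] total inc by simp
  then have "measure_prob m ?\<psi> (\<lambda>k. bit k 1 \<and> bit k 0 = f X) > 0"
    using measure_prob_split[of m ?\<psi> "\<lambda>k. bit k 1" "\<lambda>k. bit k 0 = f X"] wrong by simp
  then show "measure_prob m ?\<psi> (\<lambda>k. bit k 1 \<and> bit k 0 = b) = 0 \<longleftrightarrow> f X \<noteq> b"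
    using wrong by (cases "f X"; cases b) auto
qed

section \<open>Upper bound\<close>

text \<open>The two images of \<open>L\<close> have equal size in the finite set \<open>S\<close>,
  hence so do their complements, and any bijection between the complements completes the map. This
  makes a reversible partial step a permutation of all basis states.\<close>

lemma bij_betw_extension:
  fixes src dst :: "'a \<Rightarrow> 'b"
  assumes "finite S" "inj_on src L" "inj_on dst L" "src ` L \<subseteq> S" "dst ` L \<subseteq> S"
  obtains \<pi> where "bij_betw \<pi> S S" "\<And>x. x \<in> L \<Longrightarrow> \<pi> (src x) = dst x"
proof -
  have "card (S - src ` L) = card (S - dst ` L)"
    using assms by (simp add: card_Diff_subset finite_subset card_image)
  then obtain h where h: "bij_betw h (S - src ` L) (S - dst ` L)"
    using finite_same_card_bij[of "S - src ` L" "S - dst ` L"] assms(1) by auto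
  define \<pi> where "\<pi> y = (if y \<in> src ` L then dst (inv_into L src y) else h y)" for y
  have "bij_betw \<pi> (src ` L) (dst ` L)"
    by (rule bij_betwI'[where f = \<pi>]) 
      (use assms(2,3) in \<open>auto simp: \<pi>_def inj_on_eq_iff\<close>)
  moreover have "bij_betw \<pi> (S - src ` L) (S - dst ` L)"
    using h by (rule bij_betw_cong[THEN iffD1, rotated]) (simp add: \<pi>_def)
  ultimately have "bij_betw \<pi> (src ` L \<union> (S - src ` L)) (dst ` L \<union> (S - dst ` L))"
    by (rule bij_betw_combine) auto
  then have "bij_betw \<pi> S S" using assms(4,5) by (simp add: Un_absorb1)
  moreover have "\<pi> (src x) = dst x" if "x \<in> L" for x
    using that assms(2) by (simp add: \<pi>_def)
  ultimately show ?thesis by (rule that)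
qed

section \<open>Permutations of the basis as unitaries\<close>

definition perm_mat :: "nat \<Rightarrow> (nat \<Rightarrow> nat) \<Rightarrow> complex mat" where
  "perm_mat n \<pi> = mat n n (\<lambda>(r, c). if r = \<pi> c then 1 else 0)"

lemma perm_mat_mult_unit_vec:
  assumes "bij_betw \<pi> {..<n} {..<n}" "c < n"
  shows "perm_mat n \<pi> *\<^sub>v unit_vec n c = unit_vec n (\<pi> c)"
proof
  have "\<pi> c < n" using assms bij_betwE by fastforce
  then show "(perm_mat n \<pi> *\<^sub>v unit_vec n c) $ r = unit_vec n (\<pi> c) $ r"
    if "r < dim_vec (unit_vec n (\<pi> c))" for r
    using that assms by (simp add: perm_mat_def)
qed (simp add: perm_mat_def)

lemma unitary_perm_mat:
  assumes \<pi>: "bij_betw \<pi> {..<n} {..<n}"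
  shows "unitary_mat n (perm_mat n \<pi>)"
proof -
  have inj: "\<pi> c = \<pi> d \<longleftrightarrow> c = d" if "c < n" "d < n" for c d
    using \<pi> that by (auto simp: bij_betw_def inj_on_def)
  have less: "\<pi> c < n" if "c < n" for c using \<pi> that bij_betwE by fastforce
  have c: "perm_mat n \<pi> \<in> carrier_mat n n" by (simp add: perm_mat_def)
  have adj: "mat_adjoint (perm_mat n \<pi>) = mat n n (\<lambda>(r, c). if c = \<pi> r then 1 else 0)"
    by (rule eq_matI) (auto simp: mat_adjoint_def perm_mat_def mat_of_rows_index)
  have adj_carrier: "mat_adjoint (perm_mat n \<pi>) \<in> carrier_mat n n" unfolding adj by simp
  have "mat_adjoint (perm_mat n \<pi>) * perm_mat n \<pi> = 1\<^sub>m n"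
  proof (rule eq_matI)
    fix i j assume "i < dim_row (1\<^sub>m n)" "j < dim_col (1\<^sub>m n)"
    then have ij: "i < n" "j < n" by auto
    then have "(mat_adjoint (perm_mat n \<pi>) * perm_mat n \<pi>) $$ (i, j) =
        (\<Sum>k\<in>{0..<n}. (if k = \<pi> i then 1 else 0) * (if k = \<pi> j then 1 else 0))"
      unfolding adj by (simp add: perm_mat_def scalar_prod_def)
    also have "\<dots> = (\<Sum>k\<in>{0..<n}. if k = \<pi> i then (if i = j then 1 else 0) else 0)"
      using ij by (intro sum.cong) (auto simp: inj)
    also have "\<dots> = 1\<^sub>m n $$ (i, j)" using ij less by simp
    finally show "(mat_adjoint (perm_mat n \<pi>) * perm_mat n \<pi>) $$ (i, j) = 1\<^sub>m n $$ (i, j)" .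
  qed (use adj_carrier c in auto)
  \<comment> \<open>A one-sided inverse of a square matrix is two-sided.\<close>
  moreover from this have "perm_mat n \<pi> * mat_adjoint (perm_mat n \<pi>) = 1\<^sub>m n"
    by (rule mat_mult_left_right_inverse[rotated 2]) (auto simp: adj_carrier c)
  ultimately show ?thesis using c by (simp add: unitary_mat_def)
qed

lemma query_mat_mult_unit_vec:
  assumes "index_bits N + 1 \<le> m" "c < 2 ^ m"
  shows "query_mat N m X *\<^sub>v unit_vec (2 ^ m) c = unit_vec (2 ^ m) (query_basis N m X c)"
proof
  show "(query_mat N m X *\<^sub>v unit_vec (2 ^ m) c) $ r = unit_vec (2 ^ m) (query_basis N m X c) $ r"
    if "r < dim_vec (unit_vec (2 ^ m) (query_basis N m X c))" for r
    using that assms query_basis_less[OF assms, of X] query_basis_less[OF assms(1), of r X]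
    by (subst query_mat_mult_vec) (auto simp: query_basis_involution)
qed (simp add: query_mat_def)

lemma unitary_one_mat: "unitary_mat n (1\<^sub>m n)"
proof -
  have "mat_adjoint (1\<^sub>m n :: complex mat) = 1\<^sub>m n"
    by (rule eq_matI) (auto simp: mat_adjoint_def mat_of_rows_index)
  then show ?thesis by (simp add: unitary_mat_def)
qed

section \<open>A network that reads the whole input\<close>

lemma le_two_power_index_bits: "N \<le> 2 ^ index_bits N"
proof (cases "N = 0")
  case False
  then have "real N = 2 powr log 2 (real N)" by simp
  also have "\<dots> \<le> 2 powr real (index_bits N)"
    unfolding index_bits_def by (intro powr_mono) linarith+
  also have "\<dots> = real (2 ^ index_bits N)" by (simp add: powr_realpow)
  finally show ?thesis by (simp only: of_nat_le_iff)
qed simp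

text \<open>The least significant bit comes first, so reading another input bit does not move the
  earlier ones.\<close>

definition code :: "bool list \<Rightarrow> nat" where
  "code X = horner_sum of_bool 2 X"

lemma bit_code: "bit (code X) j \<longleftrightarrow> j < length X \<and> X ! j"
  by (simp add: code_def bit_horner_sum_bit_iff)

lemma code_less: "length X \<le> w \<Longrightarrow> code X < 2 ^ w"
  using horner_sum_of_bool_2_less[of X, where 'a = nat] unfolding code_def
  by (meson less_le_trans one_le_numeral power_increasing)

lemma inj_on_code: "inj_on code {X. length X = n}"
proof (rule inj_onI)
  fix X Y assume XY: "X \<in> {X. length X = n}" "Y \<in> {X. length X = n}" "code X = code Y"
  then show "X = Y"
    using bit_code[of X] bit_code[of Y] by (intro nth_equalityI) auto
qed

text \<open>Before query \<open>t\<close> the network is in the basis state with index register \<open>t\<close>, target bit 0 and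
  the bits read so far in the low workspace bits.  Each step from the state after query \<open>t\<close> to the
  next one is injective in the first \<open>t + 1\<close> input bits, so it extends to a permutation of the basis;
  the last step produces the output bits and keeps a copy of the input to remain injective.\<close>

lemma reading_network_exists:
  assumes N: "1 \<le> N"
  obtains m U where "2 \<le> m" "quantum_network N m N U"
    "\<And>X. length X = N \<Longrightarrow> 4 * code X + 2 + of_bool (f X) < 2 ^ m"
    "\<And>X. length X = N \<Longrightarrow>
      network_state N m U X N = unit_vec (2 ^ m) (4 * code X + 2 + of_bool (f X))"
proof -
  define m where "m = index_bits N + 1 + (N + 2)"
  define w where "w = N + 2"
  have w: "m - index_bits N - 1 = w" and m: "index_bits N + 1 \<le> m"
    by (auto simp: m_def w_def)
  define enc where "enc t X = t * 2 ^ (w + 1) + code (take t X)" for t X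
  define src where "src t X = (if X ! t then flip_bit w (enc t X) else enc t X)" for t X
  \<comment> \<open>In the last step the summand 2 sets the conclusive bit,
    \<open>of_bool (f X)\<close> is the answer bit, and the factor 4 shifts the copy of the input
    past both.\<close>
  define dst where "dst t X =
    (if Suc t = N then 4 * code X + 2 + of_bool (f X) else enc (Suc t) X)" for t X
  have code_take_less: "code (take t X) < 2 ^ w" if "t < N" for t X
    using that by (intro code_less) (auto simp: w_def)
  have enc_take_bit: "take_bit (w + 1) (enc t X) = code (take t X)" if "t < N" for t X
    using code_take_less[OF that, of X] by (simp add: enc_def take_bit_eq_mod)
  have enc_div: "enc t X div 2 ^ (w + 1) = t" if "t < N" for t X
    using code_take_less[OF that, of X] by (simp add: enc_def)
  have enc_bit: "bit (enc t X) j \<longleftrightarrow> j < t \<and> X ! j" if "t < N" "j \<le> w" "t \<le> length X" for t X j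
    using arg_cong[OF enc_take_bit[OF that(1), of X], of "\<lambda>k. bit k j"] that
    by (auto simp: bit_take_bit_iff bit_code)
  have enc_less: "enc t X < 2 ^ m" if t: "t < N" for t X
  proof -
    have "enc t X < (t + 1) * 2 ^ (w + 1)"
      using code_take_less[OF t, of X] by (simp add: enc_def)
    also have "\<dots> \<le> 2 ^ index_bits N * 2 ^ (w + 1)"
      using t le_two_power_index_bits[of N] by (intro mult_right_mono) auto
    also have "\<dots> = 2 ^ m" by (simp add: m_def w_def power_add)
    finally show ?thesis .
  qed
  have query_enc: "query_basis N m X (enc t X) = src t X" if "t < N" for t X
    unfolding query_basis_def Let_def w enc_div[OF that] using that by (simp add: src_def)
  have src_less: "src t X < 2 ^ m" if "t < N" for t X
    using query_basis_less[OF m enc_less[OF that]] query_enc[OF that] by metis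
  have dst_less: "dst t X < 2 ^ m" if "t < N" "length X = Suc t" for t X
  proof (cases "Suc t = N")
    case True
    have "code X < 2 ^ N" using that True by (intro code_less) simp
    then have "4 * code X + 2 + of_bool (f X) < 2 ^ w"
      by (cases "f X") (auto simp: w_def)
    also have "(2 :: nat) ^ w \<le> 2 ^ m" by (intro power_increasing) (auto simp: m_def w_def)
    finally show ?thesis using True by (simp add: dst_def)
  next
    case False
    then show ?thesis using enc_less[of "Suc t" X] that by (simp add: dst_def)
  qed
  have src_inj: "inj_on (src t) {X. length X = Suc t}" if t: "t < N" for t
  proof (rule inj_onI)
    fix X Y assume XY: "X \<in> {X. length X = Suc t}" "Y \<in> {X. length X = Suc t}" "src t X = src t Y"
    have b: "bit (src t Z) j \<longleftrightarrow> Z ! j" if "length Z = Suc t" "j < t" for Z j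
      using that t enc_bit[OF t, of j Z] by (auto simp: src_def bit_flip_bit_iff w_def)
    have b': "bit (src t Z) w \<longleftrightarrow> Z ! t" if "length Z = Suc t" for Z
      using that t enc_bit[OF t, of w Z] by (auto simp: src_def bit_flip_bit_iff w_def)
    show "X = Y"
    proof (rule nth_equalityI)
      fix j assume "j < length X"
      then consider "j < t" | "j = t" using XY by force
      then show "X ! j = Y ! j" using XY b[of X j] b[of Y j] b'[of X] b'[of Y] by cases auto
    qed (use XY in auto)
  qed
  have dst_inj: "inj_on (dst t) {X. length X = Suc t}" if t: "t < N" for t
  proof (rule inj_onI)
    fix X Y assume XY: "X \<in> {X. length X = Suc t}" "Y \<in> {X. length X = Suc t}" "dst t X = dst t Y"
    \<comment> \<open>Division by 4 drops the output bits; the subtraction clears the index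
      register.\<close>
    have "code Z = (if Suc t = N then dst t Z div 4 else dst t Z - Suc t * 2 ^ (w + 1))"
      if "length Z = Suc t" for Z
      using that by (cases "f Z") (auto simp: dst_def enc_def)
    then have "code X = code Y" using XY by simp
    then show "X = Y" using XY inj_on_code by (auto dest: inj_onD)
  qed
  have "\<exists>\<pi>. bij_betw \<pi> {..<2 ^ m} {..<2 ^ m} \<and> (\<forall>X. length X = Suc t \<longrightarrow> \<pi> (src t X) = dst t X)"
    if t: "t < N" for t
    using bij_betw_extension[OF _ src_inj[OF t] dst_inj[OF t], of "{..<2 ^ m}"]
      src_less[OF t] dst_less[OF t]
    by (smt (verit) finite_lessThan image_subsetI lessThan_iff mem_Collect_eq)
  then obtain \<pi> where \<pi>: "\<And>t. t < N \<Longrightarrow> bij_betw (\<pi> t) {..<2 ^ m} {..<2 ^ m}"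
    "\<And>t X. t < N \<Longrightarrow> length X = Suc t \<Longrightarrow> \<pi> t (src t X) = dst t X"
    by metis
  \<comment> \<open>The identity comes first because the initial basis state 0 already equals
    \<open>enc 0 X\<close>.\<close>
  define U where "U j = (case j of 0 \<Rightarrow> 1\<^sub>m (2 ^ m) | Suc t \<Rightarrow> perm_mat (2 ^ m) (\<pi> t))" for j
  have "quantum_network N m N U"
    using m \<pi>(1) by (auto simp: quantum_network_def U_def unitary_one_mat unitary_perm_mat split: nat.split)
  have step: "U (Suc t) *\<^sub>v (query_mat N m X *\<^sub>v unit_vec (2 ^ m) (enc t X)) =
      unit_vec (2 ^ m) (dst t (take (Suc t) X))" if "t < N" "length X = N" for t X
  proof -
    \<comment> \<open>\<open>\<pi> t\<close> is specified on lists of length \<open>Suc t\<close>;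
      only this prefix has been read so far.\<close>
    have "src t X = src t (take (Suc t) X)" by (simp add: src_def enc_def)
    then have "\<pi> t (src t X) = dst t (take (Suc t) X)" using \<pi>(2)[of t "take (Suc t) X"] that by simp
    then show ?thesis
      using that query_mat_mult_unit_vec[OF m enc_less[OF that(1)], of X X] query_enc[OF that(1)]
        perm_mat_mult_unit_vec[OF \<pi>(1)[OF that(1)], of "src t X"] src_less[OF that(1), of X]
      by (simp add: U_def)
  qed
  have state: "network_state N m U X t = unit_vec (2 ^ m) (enc t X)" if "length X = N" "t < N" for X t
    using that(2)
  proof (induction t)
    case 0
    then show ?case by (simp add: U_def enc_def code_def)
  next
    case (Suc t)
    then have "dst t (take (Suc t) X) = enc (Suc t) X" by (simp add: dst_def enc_def)
    then show ?case using Suc step[of t X] that(1) by simp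
  qed
  have "4 * code X + 2 + of_bool (f X) < 2 ^ m \<and>
      network_state N m U X N = unit_vec (2 ^ m) (4 * code X + 2 + of_bool (f X))"
    if X: "length X = N" for X
  proof -
    \<comment> \<open>The invariant \<open>state\<close> ends at \<open>N - 1\<close>, the last
      index queried; the final step is separate because there \<open>dst\<close> switches to the
      output.\<close>
    obtain t where t: "N = Suc t" using N by (cases N) auto
    have "network_state N m U X (Suc t) = unit_vec (2 ^ m) (dst t (take (Suc t) X))"
      using state[OF X, of t] step[of t X] t X by simp
    moreover have "dst t X = 4 * code X + 2 + of_bool (f X)" using t by (simp add: dst_def)
    ultimately show ?thesis using dst_less[of t X] t X by simp
  qed
  with \<open>quantum_network N m N U\<close> show ?thesis using that[of m U] by (simp add: m_def)
qed

lemma measure_prob_unit_vec: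
  assumes "c < 2 ^ m"
  shows "measure_prob m (unit_vec (2 ^ m) c) P = of_bool (P c)"
proof -
  have "measure_prob m (unit_vec (2 ^ m) c) P =
      (\<Sum>k | k < 2 ^ m \<and> P k. if k = c then 1 else 0)"
    unfolding measure_prob_def using assms by (intro sum.cong) auto
  also have "\<dots> = of_bool (P c)" using assms by (subst sum.delta) auto
  finally show ?thesis .
qed

text \<open>One network serves both models: its final basis state always has the conclusive bit set
  and \<open>f X\<close> as rightmost bit.\<close>

lemma N_queries_suffice:
  assumes "1 \<le> N"
  shows "\<exists>m U. quantum_network N m N U \<and> computes_exactly N m N U f \<and> computes_zero_error N m N U f"
proof -
  obtain m U where m: "2 \<le> m" and U: "quantum_network N m N U"
    and less: "\<And>X. length X = N \<Longrightarrow> 4 * code X + 2 + of_bool (f X) < 2 ^ m"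
    and state: "\<And>X. length X = N \<Longrightarrow>
      network_state N m U X N = unit_vec (2 ^ m) (4 * code X + 2 + of_bool (f X))"
    using reading_network_exists[OF assms, of f] by blast
  have out: "bit (4 * code X + 2 + of_bool (f X)) 0 = f X" "bit (4 * code X + 2 + of_bool (f X)) 1" for X
    by (simp_all add: bit_0 bit_iff_odd)
  have prob: "measure_prob m (network_state N m U X N) P = of_bool (P (4 * code X + 2 + of_bool (f X)))"
    if "length X = N" for X P
    unfolding state[OF that] by (rule measure_prob_unit_vec[OF less[OF that]])
  have "computes_exactly N m N U f \<and> computes_zero_error N m N U f"
    unfolding computes_exactly_def computes_zero_error_def
    using m by (simp add: prob out del: One_nat_def add_2_eq_Suc' of_bool_def)
  then show ?thesis using U by blast
qed

theorem mainTheorem8: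
  shows "\<exists>c\<^sub>1 c\<^sub>2 :: real. 0 < c\<^sub>1 \<and> 0 < c\<^sub>2 \<and>
    (\<forall>N\<ge>1. \<forall>f :: bool list \<Rightarrow> bool. symmetric_fun N f \<and> non_constant N f \<longrightarrow>
       c\<^sub>1 * real N \<le> real (Q_E N f) \<and> real (Q_E N f) \<le> c\<^sub>2 * real N \<and>
       c\<^sub>1 * real N \<le> real (Q_0 N f) \<and> real (Q_0 N f) \<le> c\<^sub>2 * real N)"
proof (rule exI[of _ "1 / 4"], rule exI[of _ 1], intro conjI allI impI)
  \<comment> \<open>The constant \<open>1 / 4\<close> comes from \<open>N + 1 \<le> 4 * T\<close>,
    the constant 1 from the network with \<open>N\<close> queries.\<close>
  fix N :: nat and f
  assume N: "1 \<le> N" and "symmetric_fun N f \<and> non_constant N f"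
  then have f: "symmetric_fun N f" "non_constant N f" by auto
  have E: "\<exists>m U. quantum_network N m N U \<and> computes_exactly N m N U f"
    and Z: "\<exists>m U. quantum_network N m N U \<and> computes_zero_error N m N U f"
    using N_queries_suffice[OF N, of f] by blast+
  \<comment> \<open>The reading network enters here too: it shows that the minimum is attained, so
    the bound applies to a network with exactly \<open>Q_E N f\<close> queries.\<close>
  have "N + 1 \<le> 4 * Q_E N f"
    using LeastI[of "\<lambda>T. \<exists>m U. quantum_network N m T U \<and> computes_exactly N m T U f", OF E]
      exact_lower_bound[OF f] unfolding Q_E_def by blast
  then show "1 / 4 * real N \<le> real (Q_E N f)" by linarith
  have "N + 1 \<le> 4 * Q_0 N f"
    using LeastI[of "\<lambda>T. \<exists>m U. quantum_network N m T U \<and> computes_zero_error N m T U f", OF Z]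
      zero_error_lower_bound[OF f] unfolding Q_0_def by blast
  then show "1 / 4 * real N \<le> real (Q_0 N f)" by linarith
  show "real (Q_E N f) \<le> 1 * real N"
    unfolding Q_E_def using Least_le[of "\<lambda>T. \<exists>m U. quantum_network N m T U \<and> computes_exactly N m T U f", OF E]
    by simp
  show "real (Q_0 N f) \<le> 1 * real N"
    unfolding Q_0_def using Least_le[of "\<lambda>T. \<exists>m U. quantum_network N m T U \<and> computes_zero_error N m T U f", OF Z]
    by simp
qed simp_all

end
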